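(* Let $(A,\cdot,P_{\Omega})$ be a matching Rota-Baxter algebra of weight $\lambda_\Omega$ and let $p: A \rightarrow A$ be an algebra endomorphism which commutes with $P_{\omega}$ for all $\omega \in \Omega$. Then $(A, \cdot_{p}, P_{\Omega}, p)$, where $x\cdot_{p}y:= p(x \cdot y)$, is a matching Hom-associative Rota-Baxter algebra of weight $\lambda_\Omega$.
   Context: Let $\mathbf{k}$ be a unitary commutative ring, the base ring of all modules, algebras and linear maps, and let $\Omega$ be a nonempty set. Let $\lambda_{\Omega}=(\lambda_{\omega})_{\omega\in \Omega}$ be a family of scalars in $\mathbf{k}$. A matching Rota-Baxter algebra of weight $\lambda_{\Omega}$ is an associative algebra $(A,\cdot)$ equipped with a family $P_\Omega=(P_\omega)_{\omega\in \Omega}$ of linear operators $P_\omega: A\to A$ satisfying the matching Rota-Baxter equation $$P_{\alpha}(x) \cdot P_{\beta}(y)=P_{\alpha}(x \cdot P_{\beta}(y))+P_{\beta}(P_{\alpha}(x) \cdot y)+ \lambda_{\beta}P_{\alpha}(x \cdot y)\quad\text{for all } x,y \in A,\ \alpha, \beta \in \Omega.$$ A Hom-associative algebra is a triple $(A,\cdot,p)$ with $A$ a $\mathbf{k}$-module, $\cdot:A\otimes A\to A$ bilinear and $p:A\to A$ linear, such that $(x\cdot y)\cdot p(z)=p(x)\cdot(y\cdot z)$ for all $x,y,z\in A$. A matching Hom-associative Rota-Baxter algebra of weight $\lambda_\Omega$ is a quadruple $(A,\cdot,P_\Omega,p)$ where $(A,\cdot,p)$ is a Hom-associative algebra and $P_\Omega$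 is a family of linear operators on $A$ satisfying the matching Rota-Baxter equation of weight $\lambda_\Omega$ with respect to $\cdot$. *)

theory Defs
  imports "HOL-Algebra.Module"
begin

text \<open>
  A \<open>k\<close>-algebra is carried by a \<open>module\<close> record whose \<open>mult\<close> field is the product; its \<open>one\<close>
  field is never constrained, so algebras need not be unital. The library locale
  \<^locale>\<open>algebra\<close> is not used because it requires a commutative unital associative product.
  The operators \<open>P\<^sub>\<omega>\<close> and the scalars \<open>lam \<omega>\<close> are given by total functions, of which
  only the values at indices in \<open>\<Omega>\<close> matter.
\<close>

definition linear_endos ::
    "('k, 'm) ring_scheme \<Rightarrow> ('k, 'a, 'n) module_scheme \<Rightarrow> ('a \<Rightarrow> 'a) set"
  where "linear_endos R A =
    {f \<in> hom (add_monoid A) (add_monoid A).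
      \<forall>c \<in> carrier R. \<forall>x \<in> carrier A. f (c \<odot>\<^bsub>A\<^esub> x) = c \<odot>\<^bsub>A\<^esub> f x}"

locale bilinear_algebra = module R A
  for R (structure) and A (structure) +
  assumes mult_closed:
      "\<lbrakk>x \<in> carrier A; y \<in> carrier A\<rbrakk> \<Longrightarrow> x \<otimes>\<^bsub>A\<^esub> y \<in> carrier A"
    and mult_add_left:
      "\<lbrakk>x \<in> carrier A; y \<in> carrier A; z \<in> carrier A\<rbrakk> \<Longrightarrow>
        (x \<oplus>\<^bsub>A\<^esub> y) \<otimes>\<^bsub>A\<^esub> z = x \<otimes>\<^bsub>A\<^esub> z \<oplus>\<^bsub>A\<^esub> y \<otimes>\<^bsub>A\<^esub> z"
    and mult_add_right:
      "\<lbrakk>x \<in> carrier A; y \<in> carrier A; z \<in> carrier A\<rbrakk> \<Longrightarrow>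
        x \<otimes>\<^bsub>A\<^esub> (y \<oplus>\<^bsub>A\<^esub> z) = x \<otimes>\<^bsub>A\<^esub> y \<oplus>\<^bsub>A\<^esub> x \<otimes>\<^bsub>A\<^esub> z"
    and mult_smult_left:
      "\<lbrakk>c \<in> carrier R; x \<in> carrier A; y \<in> carrier A\<rbrakk> \<Longrightarrow>
        (c \<odot>\<^bsub>A\<^esub> x) \<otimes>\<^bsub>A\<^esub> y = c \<odot>\<^bsub>A\<^esub> (x \<otimes>\<^bsub>A\<^esub> y)"
    and mult_smult_right:
      "\<lbrakk>c \<in> carrier R; x \<in> carrier A; y \<in> carrier A\<rbrakk> \<Longrightarrow>
        x \<otimes>\<^bsub>A\<^esub> (c \<odot>\<^bsub>A\<^esub> y) = c \<odot>\<^bsub>A\<^esub> (x \<otimes>\<^bsub>A\<^esub> y)"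

locale assoc_algebra = bilinear_algebra +
  assumes mult_assoc:
    "\<lbrakk>x \<in> carrier A; y \<in> carrier A; z \<in> carrier A\<rbrakk> \<Longrightarrow>
      (x \<otimes>\<^bsub>A\<^esub> y) \<otimes>\<^bsub>A\<^esub> z = x \<otimes>\<^bsub>A\<^esub> (y \<otimes>\<^bsub>A\<^esub> z)"

locale hom_assoc_algebra = bilinear_algebra +
  fixes p :: "'c \<Rightarrow> 'c"
  assumes twist_linear: "p \<in> linear_endos R A"
    and hom_assoc:
      "\<lbrakk>x \<in> carrier A; y \<in> carrier A; z \<in> carrier A\<rbrakk> \<Longrightarrow>
        (x \<otimes>\<^bsub>A\<^esub> y) \<otimes>\<^bsub>A\<^esub> p z = p x \<otimes>\<^bsub>A\<^esub> (y \<otimes>\<^bsub>A\<^esub> z)"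

locale matching_rota_baxter_operators = bilinear_algebra +
  fixes \<Omega> :: "'i set" and lam :: "'i \<Rightarrow> 'a" and P :: "'i \<Rightarrow> 'c \<Rightarrow> 'c"
  assumes index_nonempty: "\<Omega> \<noteq> {}"
    and weight_closed: "\<omega> \<in> \<Omega> \<Longrightarrow> lam \<omega> \<in> carrier R"
    and operator_linear: "\<omega> \<in> \<Omega> \<Longrightarrow> P \<omega> \<in> linear_endos R A"
    and matching_rota_baxter:
      "\<lbrakk>\<alpha> \<in> \<Omega>; \<beta> \<in> \<Omega>; x \<in> carrier A; y \<in> carrier A\<rbrakk> \<Longrightarrow>
        P \<alpha> x \<otimes>\<^bsub>A\<^esub> P \<beta> y =
          P \<alpha> (x \<otimes>\<^bsub>A\<^esub> P \<beta> y) \<oplus>\<^bsub>A\<^esub> P \<beta> (P \<alpha> x \<otimes>\<^bsub>A\<^esub> y)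
            \<oplus>\<^bsub>A\<^esub> lam \<beta> \<odot>\<^bsub>A\<^esub> P \<alpha> (x \<otimes>\<^bsub>A\<^esub> y)"

locale matching_rota_baxter_algebra =
  assoc_algebra R A + matching_rota_baxter_operators R A \<Omega> lam P
  for R (structure) and A (structure) and \<Omega> lam P

locale matching_hom_assoc_rota_baxter_algebra =
  hom_assoc_algebra R A p + matching_rota_baxter_operators R A \<Omega> lam P
  for R (structure) and A (structure) and \<Omega> lam P p

text \<open>The library's \<open>hom A A\<close> consists of the multiplicative self-maps of the carrier.\<close>

definition algebra_endos ::
    "('k, 'm) ring_scheme \<Rightarrow> ('k, 'a, 'n) module_scheme \<Rightarrow> ('a \<Rightarrow> 'a) set"
  where "algebra_endos R A = linear_endos R A \<inter> hom A A"

definition twist_mult ::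
    "('k, 'a, 'n) module_scheme \<Rightarrow> ('a \<Rightarrow> 'a) \<Rightarrow> ('k, 'a, 'n) module_scheme"
  where "twist_mult A p = A\<lparr>mult := (\<lambda>x y. p (x \<otimes>\<^bsub>A\<^esub> y))\<rparr>"

end

theory Submission
  imports Defs
begin

text \<open>
  Twisting along an algebra endomorphism (the Yau twist) turns associativity into
  Hom-associativity: multiplicativity of \<open>p\<close> makes both \<open>(x \<cdot>\<^sub>p y) \<cdot>\<^sub>p p z\<close> and
  \<open>p x \<cdot>\<^sub>p (y \<cdot>\<^sub>p z)\<close> equal to \<open>p\<close> applied twice to the product of \<open>x\<close>, \<open>y\<close> and \<open>z\<close>
  (\<open>twist_mult_hom_assoc_algebra\<close>). The matching Rota-Baxter equation for \<open>\<cdot>\<^sub>p\<close> is the image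
  under \<open>p\<close> of the original one: every summand on the right is, up to a scalar, some \<open>P\<^sub>\<omega>\<close>
  of a product, so moving \<open>p\<close> past \<open>P\<^sub>\<omega>\<close> replaces that product by its twist
  (\<open>twist_mult_matching_rota_baxter_operators\<close>).
\<close>

lemma linear_endosD:
  assumes "f \<in> linear_endos R A"
  shows linear_endos_closed: "x \<in> carrier A \<Longrightarrow> f x \<in> carrier A"
    and linear_endos_add:
      "\<lbrakk>x \<in> carrier A; y \<in> carrier A\<rbrakk> \<Longrightarrow> f (x \<oplus>\<^bsub>A\<^esub> y) = f x \<oplus>\<^bsub>A\<^esub> f y"
    and linear_endos_smult:
      "\<lbrakk>c \<in> carrier R; x \<in> carrier A\<rbrakk> \<Longrightarrow> f (c \<odot>\<^bsub>A\<^esub> x) = c \<odot>\<^bsub>A\<^esub> f x"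
  using assms by (auto simp: linear_endos_def hom_def)

lemma twist_mult_sel [simp]:
  "carrier (twist_mult A p) = carrier A"
  "x \<otimes>\<^bsub>twist_mult A p\<^esub> y = p (x \<otimes>\<^bsub>A\<^esub> y)"
  "zero (twist_mult A p) = zero A"
  "add (twist_mult A p) = add A"
  "smult (twist_mult A p) = smult A"
  by (simp_all add: twist_mult_def)

lemma linear_endos_twist_mult [simp]: "linear_endos R (twist_mult A p) = linear_endos R A"
  by (simp add: linear_endos_def)

lemma (in module) twist_mult_module: "module R (twist_mult M p)"
proof (rule module.intro)
  show "abelian_group (twist_mult M p)"
    using abelian_group_axioms
    by (simp add: abelian_group_def abelian_monoid_def abelian_group_axioms_def)
  show "module_axioms R (twist_mult M p)"
    using module_axioms by (simp add: module_def module_axioms_def)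
qed (rule is_cring)

lemma (in bilinear_algebra) twist_mult_bilinear_algebra:
  assumes p: "p \<in> linear_endos R A"
  shows "bilinear_algebra R (twist_mult A p)"
  by (intro bilinear_algebra.intro twist_mult_module bilinear_algebra_axioms.intro)
    (simp_all add: linear_endosD[OF p] mult_closed mult_add_left mult_add_right
      mult_smult_left mult_smult_right)

lemma (in assoc_algebra) twist_mult_hom_assoc_algebra:
  assumes p: "p \<in> algebra_endos R A"
  shows "hom_assoc_algebra R (twist_mult A p) p"
proof -
  have lin: "p \<in> linear_endos R A"
    using p by (simp add: algebra_endos_def)
  have mult: "p (x \<otimes>\<^bsub>A\<^esub> y) = p x \<otimes>\<^bsub>A\<^esub> p y"
    if "x \<in> carrier A" "y \<in> carrier A" for x y
    using p that by (simp add: algebra_endos_def hom_def)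
  have "p (p (x \<otimes>\<^bsub>A\<^esub> y) \<otimes>\<^bsub>A\<^esub> p z) = p (p x \<otimes>\<^bsub>A\<^esub> p (y \<otimes>\<^bsub>A\<^esub> z))"
    if "x \<in> carrier A" "y \<in> carrier A" "z \<in> carrier A" for x y z
    \<comment> \<open>Multiplicativity is read from right to left, pulling \<open>p\<close> out of the products;
      what remains is associativity under \<open>p \<circ> p\<close>.\<close>
    using that by (simp add: mult[symmetric] mult_closed mult_assoc)
  then show ?thesis
    by (intro hom_assoc_algebra.intro twist_mult_bilinear_algebra[OF lin]
        hom_assoc_algebra_axioms.intro) (simp_all add: lin)
qed

lemma (in matching_rota_baxter_operators) twist_mult_matching_rota_baxter_operators:
  assumes p: "p \<in> linear_endos R A"
    and commute: "\<And>\<omega> x. \<lbrakk>\<omega> \<in> \<Omega>; x \<in> carrier A\<rbrakk> \<Longrightarrow> p (P \<omega> x) = P \<omega> (p x)"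
  shows "matching_rota_baxter_operators R (twist_mult A p) \<Omega> lam P"
proof -
  have "p (P \<alpha> x \<otimes>\<^bsub>A\<^esub> P \<beta> y) =
      P \<alpha> (p (x \<otimes>\<^bsub>A\<^esub> P \<beta> y)) \<oplus>\<^bsub>A\<^esub> P \<beta> (p (P \<alpha> x \<otimes>\<^bsub>A\<^esub> y))
        \<oplus>\<^bsub>A\<^esub> lam \<beta> \<odot>\<^bsub>A\<^esub> P \<alpha> (p (x \<otimes>\<^bsub>A\<^esub> y))"
    if "\<alpha> \<in> \<Omega>" "\<beta> \<in> \<Omega>" "x \<in> carrier A" "y \<in> carrier A" for \<alpha> \<beta> x y
    using that
    by (simp add: matching_rota_baxter linear_endosD[OF p] mult_closed weight_closed
        linear_endos_closed[OF operator_linear] commute)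
  then show ?thesis
    by (intro matching_rota_baxter_operators.intro twist_mult_bilinear_algebra[OF p]
        matching_rota_baxter_operators_axioms.intro)
      (simp_all add: index_nonempty weight_closed operator_linear)
qed

theorem theorem3p3:
  fixes R :: "('k, 'm) ring_scheme"
    and A :: "('k, 'a, 'n) module_scheme"
    and \<Omega> :: "'i set"
    and lam :: "'i \<Rightarrow> 'k"
    and P :: "'i \<Rightarrow> 'a \<Rightarrow> 'a"
    and p :: "'a \<Rightarrow> 'a"
  assumes "matching_rota_baxter_algebra R A \<Omega> lam P"
    and "p \<in> algebra_endos R A"
    and "\<And>\<omega> x. \<lbrakk>\<omega> \<in> \<Omega>; x \<in> carrier A\<rbrakk> \<Longrightarrow> p (P \<omega> x) = P \<omega> (p x)"
  shows "matching_hom_assoc_rota_baxter_algebra R (twist_mult A p) \<Omega> lam P p"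
proof -
  interpret matching_rota_baxter_algebra R A \<Omega> lam P
    by (fact assms(1))
  have "p \<in> linear_endos R A"
    using assms(2) by (simp add: algebra_endos_def)
  then show ?thesis
    using assms(2,3)
    by (intro matching_hom_assoc_rota_baxter_algebra.intro twist_mult_hom_assoc_algebra
        twist_mult_matching_rota_baxter_operators)
qed

end
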